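(* Let $n\ge 2$, let $\Phi:[0,1]_{\mathbb D}\to\mathbb D^{+}$ be an admissible hyperbolic generator, and let $\mathcal N_\Phi:\mathcal P_{\mathbb D}(n)\to\mathcal P_{\mathbb D}(n)$ be the hyperbolic negator generated by $\Phi$. For $\ell=1,2$, set $Z_\ell^\Phi=\Phi^{(\ell)}(1)+(n-1)\Phi^{(\ell)}(0)$, and define \[ \phi_0^{\Phi}=\frac{\Phi^{(1)}(0)}{Z_1^\Phi}\mathbf e_1+\frac{\Phi^{(2)}(0)}{Z_2^\Phi}\mathbf e_2 . \] If $\Phi(\phi_0^\Phi)\ne 0$, then $\mathcal N_\Phi$ is not involutive, i.e. it is not the case that $\mathcal N_\Phi(\mathcal N_\Phi(P))=P$ for all $P\in\mathcal P_{\mathbb D}(n)$.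
   Context: Hyperbolic numbers: $\mathbb D=\{a+\mathbf k b: a,b\in\mathbb R\}$ with $\mathbf k^2=1$, $\mathbf e_1=(1+\mathbf k)/2$, $\mathbf e_2=(1-\mathbf k)/2$. Every $z\in\mathbb D$ is uniquely $z=z^{(1)}\mathbf e_1+z^{(2)}\mathbf e_2$ with $z^{(1)},z^{(2)}\in\mathbb R$; addition and multiplication are component-wise in these coordinates, and $1=\mathbf e_1+\mathbf e_2$. Partial order: $z\preceq_{\mathbb D}w$ iff $z^{(1)}\le w^{(1)}$ and $z^{(2)}\le w^{(2)}$. $\mathbb D^{+}=\{z: 0\preceq_{\mathbb D}z\}$ and $[0,1]_{\mathbb D}=\{z: 0\preceq_{\mathbb D}z\preceq_{\mathbb D}1\}$. Distributions: $\mathcal P_{\mathbb D}(n)$ is the set of $P=(p_1,\ldots,p_n)\in\mathbb D^n$ with all $p_j\in[0,1]_{\mathbb D}$ and $s(P):=\sum_j p_j\in\{1,\mathbf e_1,\mathbf e_2\}$. Write $p_j=p_j^{(1)}\mathbf e_1+p_j^{(2)}\mathbf e_2$, $s^{(\ell)}(P)=\sum_j p_j^{(\ell)}\in\{0,1\}$. Component $\ell$ of $P$ is active if $s^{(\ell)}(P)=1$ and inactive if $s^{(\ell)}(P)=0$. Generators: a map $\Phi=\Phi^{(1)}\mathbf e_1+\Phi^{(2)}\mathbf e_2:[0,1]_{\mathbb D}\to\mathbb D^{+}$ is an admissible hyperbolic generator (for the given $n$) if (i) $z\preceq_{\mathbb D}w$ implies $\Phi(w)\preceq_{\mathbb D}\Phi(z)$,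 and (ii) for every $P\in\mathcal P_{\mathbb D}(n)$ and every active component $\ell$ of $P$, $Z_\ell^\Phi(P):=\sum_{j=1}^n\Phi^{(\ell)}(p_j)>0$. (In particular $Z_\ell^\Phi$ in the claim is $Z_\ell^\Phi(V)>0$ for $V=(1,0,\ldots,0)$.) The generated negator is $\mathcal N_\Phi(P)=(q_1,\ldots,q_n)$ with $q_j^{(\ell)}=\Phi^{(\ell)}(p_j)/Z_\ell^\Phi(P)$ if component $\ell$ of $P$ is active, and $q_j^{(\ell)}=0$ if it is inactive. *)

theory Defs
  imports Complex_Main
begin

text \<open>
  The hyperbolic number \<open>a + k b\<close> is encoded by its pair of real coordinates \<open>(a, b)\<close>.
\<close>

datatype hyperbolic = Hyp (hre: real) (him: real)

instantiation hyperbolic :: comm_ring_1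
begin

definition "0 = Hyp 0 0"
definition "1 = Hyp 1 0"
definition "z + w = Hyp (hre z + hre w) (him z + him w)"
definition "z - w = Hyp (hre z - hre w) (him z - him w)"
definition "- z = Hyp (- hre z) (- him z)"
definition "z * w = Hyp (hre z * hre w + him z * him w) (hre z * him w + him z * hre w)"

instance
  by standard
    (simp_all add: zero_hyperbolic_def one_hyperbolic_def plus_hyperbolic_def
      minus_hyperbolic_def uminus_hyperbolic_def times_hyperbolic_def algebra_simps)

end

instantiation hyperbolic :: real_algebra_1
begin

definition "r *\<^sub>R z = Hyp (r * hre z) (r * him z)"

instance
  by standard
    (simp_all add: scaleR_hyperbolic_def plus_hyperbolic_def times_hyperbolic_def
      algebra_simps)

end

definition hyp_k :: hyperbolic where
  "hyp_k = Hyp 0 1"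

lemma hyp_k_square: "hyp_k * hyp_k = 1"
  by (simp add: hyp_k_def times_hyperbolic_def one_hyperbolic_def)

lemma hyperbolic_eq: "Hyp a b = of_real a + hyp_k * of_real b"
  by (simp add: hyp_k_def of_real_def scaleR_hyperbolic_def one_hyperbolic_def
      plus_hyperbolic_def times_hyperbolic_def)

definition hyp_e1 :: hyperbolic where
  "hyp_e1 = (1 / 2) *\<^sub>R (1 + hyp_k)"

definition hyp_e2 :: hyperbolic where
  "hyp_e2 = (1 / 2) *\<^sub>R (1 - hyp_k)"

datatype component = C1 | C2

text \<open>
  \<open>hcomp C1 z\<close> and \<open>hcomp C2 z\<close> are the coordinates of \<open>z\<close> in the basis
  \<open>hyp_e1\<close>, \<open>hyp_e2\<close>; see \<open>hyp_idempotent_decomp_unique\<close>.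
\<close>

fun hcomp :: "component \<Rightarrow> hyperbolic \<Rightarrow> real" where
  "hcomp C1 z = hre z + him z"
| "hcomp C2 z = hre z - him z"

lemmas hyp_defs = zero_hyperbolic_def one_hyperbolic_def plus_hyperbolic_def
  minus_hyperbolic_def uminus_hyperbolic_def times_hyperbolic_def scaleR_hyperbolic_def
  hyp_k_def hyp_e1_def hyp_e2_def

lemma hyp_idempotent_decomp_unique:
  "z = a *\<^sub>R hyp_e1 + b *\<^sub>R hyp_e2 \<longleftrightarrow> a = hcomp C1 z \<and> b = hcomp C2 z"
  by (cases z) (auto simp: hyp_defs field_simps)

lemma hyp_eq_iff: "z = w \<longleftrightarrow> (\<forall>l. hcomp l z = hcomp l w)"
proof
  assume "\<forall>l. hcomp l z = hcomp l w"
  then have "hcomp C1 z = hcomp C1 w" "hcomp C2 z = hcomp C2 w" by blast+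
  then show "z = w" by (cases z; cases w) simp
qed simp

lemma hcomp_simps [simp]:
  "hcomp l 0 = 0" "hcomp l 1 = 1"
  "hcomp l (z + w) = hcomp l z + hcomp l w"
  "hcomp l (z - w) = hcomp l z - hcomp l w"
  "hcomp l (- z) = - hcomp l z"
  "hcomp l (z * w) = hcomp l z * hcomp l w"
  "hcomp l (r *\<^sub>R z) = r * hcomp l z"
  "hcomp l hyp_e1 = (if l = C1 then 1 else 0)"
  "hcomp l hyp_e2 = (if l = C2 then 1 else 0)"
  by (cases l; simp add: hyp_defs algebra_simps)+

lemma hcomp_sum_list: "hcomp l (sum_list zs) = (\<Sum>z\<leftarrow>zs. hcomp l z)"
  by (induction zs) (simp_all del: hcomp.simps)

lemma hyp_e1_plus_e2: "hyp_e1 + hyp_e2 = 1"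
  by (simp add: hyp_defs)

instantiation hyperbolic :: order
begin

definition "z \<le> w \<longleftrightarrow> hcomp C1 z \<le> hcomp C1 w \<and> hcomp C2 z \<le> hcomp C2 w"
definition "z < w \<longleftrightarrow> z \<le> w \<and> \<not> w \<le> (z :: hyperbolic)"

instance
proof
  fix x y z :: hyperbolic
  show "x < y \<longleftrightarrow> x \<le> y \<and> \<not> y \<le> x" by (rule less_hyperbolic_def)
  show "x \<le> x" by (simp add: less_eq_hyperbolic_def)
  show "x \<le> y \<Longrightarrow> y \<le> z \<Longrightarrow> x \<le> z" by (simp add: less_eq_hyperbolic_def)
  show "x \<le> y \<Longrightarrow> y \<le> x \<Longrightarrow> x = y"
    by (cases x; cases y) (simp add: less_eq_hyperbolic_def)
qed

end

lemma hyp_le_iff: "z \<le> w \<longleftrightarrow> (\<forall>l. hcomp l z \<le> hcomp l w)"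
  unfolding less_eq_hyperbolic_def by (metis component.exhaust)

text \<open>
  Vectors in the \<open>n\<close>-fold power of the hyperbolic numbers are lists of length \<open>n\<close>.
  With the product order, \<open>{0..1}\<close> is the hyperbolic unit interval and \<open>{0..}\<close> the
  set of nonnegative hyperbolic numbers.
\<close>

definition hyp_distributions :: "nat \<Rightarrow> hyperbolic list set" where
  "hyp_distributions n =
    {P. length P = n \<and> set P \<subseteq> {0..1} \<and> sum_list P \<in> {1, hyp_e1, hyp_e2}}"

definition active :: "component \<Rightarrow> hyperbolic list \<Rightarrow> bool" where
  "active l P \<longleftrightarrow> (\<Sum>p\<leftarrow>P. hcomp l p) = 1"

definition gen_Z :: "(hyperbolic \<Rightarrow> hyperbolic) \<Rightarrow> component \<Rightarrow> hyperbolic list \<Rightarrow> real" where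
  "gen_Z \<Phi> l P = (\<Sum>p\<leftarrow>P. hcomp l (\<Phi> p))"

text \<open>Only the values of \<open>\<Phi>\<close> on \<open>{0..1}\<close> are relevant.\<close>

definition admissible_generator :: "nat \<Rightarrow> (hyperbolic \<Rightarrow> hyperbolic) \<Rightarrow> bool" where
  "admissible_generator n \<Phi> \<longleftrightarrow>
    (\<forall>z\<in>{0..1}. \<Phi> z \<in> {0..}) \<and>
    (\<forall>z\<in>{0..1}. \<forall>w\<in>{0..1}. z \<le> w \<longrightarrow> \<Phi> w \<le> \<Phi> z) \<and>
    (\<forall>P\<in>hyp_distributions n. \<forall>l. active l P \<longrightarrow> gen_Z \<Phi> l P > 0)"

definition negator_comp ::
    "(hyperbolic \<Rightarrow> hyperbolic) \<Rightarrow> hyperbolic list \<Rightarrow> component \<Rightarrow> hyperbolic \<Rightarrow> real" where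
  "negator_comp \<Phi> P l p = (if active l P then hcomp l (\<Phi> p) / gen_Z \<Phi> l P else 0)"

definition negator :: "(hyperbolic \<Rightarrow> hyperbolic) \<Rightarrow> hyperbolic list \<Rightarrow> hyperbolic list" where
  "negator \<Phi> P =
    map (\<lambda>p. negator_comp \<Phi> P C1 p *\<^sub>R hyp_e1 + negator_comp \<Phi> P C2 p *\<^sub>R hyp_e2) P"

definition vertex_Z :: "nat \<Rightarrow> (hyperbolic \<Rightarrow> hyperbolic) \<Rightarrow> component \<Rightarrow> real" where
  "vertex_Z n \<Phi> l = hcomp l (\<Phi> 1) + (real n - 1) * hcomp l (\<Phi> 0)"

definition phi0 :: "nat \<Rightarrow> (hyperbolic \<Rightarrow> hyperbolic) \<Rightarrow> hyperbolic" where
  "phi0 n \<Phi> =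
    (hcomp C1 (\<Phi> 0) / vertex_Z n \<Phi> C1) *\<^sub>R hyp_e1 +
    (hcomp C2 (\<Phi> 0) / vertex_Z n \<Phi> C2) *\<^sub>R hyp_e2"

lemma active_iff_sum: "active l P \<longleftrightarrow> hcomp l (sum_list P) = 1"
  by (simp add: active_def hcomp_sum_list)

lemma inactive_iff:
  assumes "P \<in> hyp_distributions n"
  shows "\<not> active l P \<longleftrightarrow> (\<Sum>p\<leftarrow>P. hcomp l p) = 0"
  using assms unfolding active_iff_sum hcomp_sum_list [symmetric]
  by (auto simp: hyp_distributions_def simp del: hcomp.simps split: if_splits)

lemma hcomp_negator_comp:
  "hcomp l (negator_comp \<Phi> P C1 p *\<^sub>R hyp_e1 + negator_comp \<Phi> P C2 p *\<^sub>R hyp_e2) =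
    negator_comp \<Phi> P l p"
  by (cases l) (simp_all del: hcomp.simps)

lemma sum_list_negator:
  assumes "admissible_generator n \<Phi>" "P \<in> hyp_distributions n"
  shows "sum_list (negator \<Phi> P) = sum_list P"
proof -
  have "hcomp l (sum_list (negator \<Phi> P)) = hcomp l (sum_list P)" for l
  proof -
    have "hcomp l (sum_list (negator \<Phi> P)) = (\<Sum>p\<leftarrow>P. negator_comp \<Phi> P l p)"
      by (simp only: hcomp_sum_list negator_def map_map comp_def hcomp_negator_comp)
    also have "\<dots> = (\<Sum>p\<leftarrow>P. hcomp l p)"
    proof (cases "active l P")
      case True
      then have "gen_Z \<Phi> l P > 0"
        using assms by (auto simp: admissible_generator_def)
      moreover have "(\<Sum>p\<leftarrow>P. negator_comp \<Phi> P l p) = gen_Z \<Phi> l P / gen_Z \<Phi> l P"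
        using True
        by (simp add: negator_comp_def divide_inverse sum_list_mult_const
            gen_Z_def [of \<Phi> l P, symmetric])
      ultimately show ?thesis
        using True by (simp add: active_def)
    next
      case False
      then show ?thesis
        using inactive_iff [OF assms(2), of l] by (simp add: negator_comp_def)
    qed
    finally show ?thesis
      by (simp only: hcomp_sum_list)
  qed
  then show ?thesis
    by (simp add: hyp_eq_iff del: hcomp.simps)
qed

lemma negator_in_distributions:
  assumes "admissible_generator n \<Phi>" "P \<in> hyp_distributions n"
  shows "negator \<Phi> P \<in> hyp_distributions n"
proof -
  have "0 \<le> negator_comp \<Phi> P l p \<and> negator_comp \<Phi> P l p \<le> 1" if p: "p \<in> set P" for l p
  proof (cases "active l P")
    case True
    have nn: "0 \<le> hcomp l (\<Phi> q)" if "q \<in> set P" for q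
    proof -
      have "q \<in> {0..1}" using that assms(2) by (auto simp: hyp_distributions_def)
      then have "0 \<le> \<Phi> q" using assms(1) by (auto simp: admissible_generator_def)
      then have "hcomp l 0 \<le> hcomp l (\<Phi> q)" unfolding hyp_le_iff by blast
      then show ?thesis by (simp del: hcomp.simps)
    qed
    have Z: "gen_Z \<Phi> l P > 0"
      using True assms by (auto simp: admissible_generator_def)
    have "hcomp l (\<Phi> p) \<le> gen_Z \<Phi> l P"
      unfolding gen_Z_def using p nn by (intro member_le_sum_list) auto
    with Z nn [OF p] True show ?thesis
      by (simp add: negator_comp_def)
  qed (simp add: negator_comp_def)
  then have "set (negator \<Phi> P) \<subseteq> {0..1}"
    by (auto simp: negator_def hyp_le_iff hcomp_negator_comp simp del: hcomp.simps
        hcomp_simps(3,7))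
  then show ?thesis
    using assms(2) sum_list_negator [OF assms]
    by (auto simp: hyp_distributions_def negator_def)
qed

lemma vertex_Z_eq:
  assumes "n \<ge> 1"
  shows "vertex_Z n \<Phi> l = gen_Z \<Phi> l (1 # replicate (n - 1) 0)"
  using assms by (simp add: vertex_Z_def gen_Z_def sum_list_replicate of_nat_diff)

lemma vertex_in_distributions:
  assumes "n \<ge> 1"
  shows "1 # replicate (n - 1) 0 \<in> hyp_distributions n"
  using assms
  by (auto simp: hyp_distributions_def sum_list_replicate hyp_le_iff simp del: hcomp.simps)

lemma phi0_in_unit:
  assumes "n \<ge> 2" "admissible_generator n \<Phi>"
  shows "phi0 n \<Phi> \<in> {0..1}"
proof -
  define V :: "hyperbolic list" where "V = 1 # replicate (n - 1) 0"
  have V: "V \<in> hyp_distributions n"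
    using assms(1) vertex_in_distributions [of n] by (simp add: V_def)
  have "active l V" for l
    by (simp add: active_def V_def sum_list_replicate del: hcomp.simps)
  then have "negator_comp \<Phi> V l 0 = hcomp l (\<Phi> 0) / vertex_Z n \<Phi> l" for l
    using assms(1) vertex_Z_eq [of n \<Phi> l] by (simp add: negator_comp_def V_def)
  then have "phi0 n \<Phi> =
      negator_comp \<Phi> V C1 0 *\<^sub>R hyp_e1 + negator_comp \<Phi> V C2 0 *\<^sub>R hyp_e2"
    by (simp add: phi0_def)
  moreover have "0 \<in> set V"
    using assms(1) by (simp add: V_def)
  ultimately have "phi0 n \<Phi> \<in> set (negator \<Phi> V)"
    by (simp add: negator_def)
  then show ?thesis
    using negator_in_distributions [OF assms(2) V] by (auto simp: hyp_distributions_def)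
qed

end

theory Submission
  imports Defs
begin

text \<open>
  For the vertex \<open>V = (1, 0, \<dots>, 0)\<close> every zero entry is sent to \<open>phi0\<close> by the negator. If the
  negator were involutive, the entries \<open>phi0\<close> of the image would have to be sent back to \<open>0\<close>;
  both components are active with positive normalisation, so this forces \<open>\<Phi> phi0 = 0\<close>.
\<close>

lemma hcomp_negator_nth:
  assumes "i < length P"
  shows "hcomp l (negator \<Phi> P ! i) = negator_comp \<Phi> P l (P ! i)"
  using assms by (simp only: negator_def nth_map hcomp_negator_comp)

lemma hcomp_phi0: "hcomp l (phi0 n \<Phi>) = hcomp l (\<Phi> 0) / vertex_Z n \<Phi> l"
  by (cases l) (simp_all add: phi0_def del: hcomp.simps)

text \<open>On an active component the entry is a quotient by the positive \<open>gen_Z\<close>, so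
  it vanishes only with its numerator. Activity matters: inactive components are zero whatever
  \<open>\<Phi>\<close> is.\<close>

lemma negator_nth_eq_0_imp:
  assumes "admissible_generator n \<Phi>" "P \<in> hyp_distributions n"
    and "active l P" "i < n" "negator \<Phi> P ! i = 0"
  shows "hcomp l (\<Phi> (P ! i)) = 0"
proof -
  have "i < length P"
    using assms(2,4) by (simp add: hyp_distributions_def)
  then have "negator_comp \<Phi> P l (P ! i) = 0"
    using hcomp_negator_nth [of i P l \<Phi>] assms(5) by (simp del: hcomp.simps)
  moreover have "gen_Z \<Phi> l P > 0"
    using assms(1-3) by (auto simp: admissible_generator_def)
  ultimately show ?thesis
    using assms(3) by (simp add: negator_comp_def del: hcomp.simps)
qed

theorem theorem4p2:
  fixes n :: nat and \<Phi> :: "hyperbolic \<Rightarrow> hyperbolic"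
  assumes "n \<ge> 2"
    and "admissible_generator n \<Phi>"
    and "\<Phi> (phi0 n \<Phi>) \<noteq> 0"
  shows "\<not> (\<forall>P\<in>hyp_distributions n. negator \<Phi> (negator \<Phi> P) = P)"
proof
  assume inv: "\<forall>P\<in>hyp_distributions n. negator \<Phi> (negator \<Phi> P) = P"
  define V :: "hyperbolic list" where "V = 1 # replicate (n - 1) 0"
  \<comment> \<open>Index 1 is the first zero entry of \<open>V\<close>; it exists because
    \<open>n \<ge> 2\<close>.\<close>
  have V: "V \<in> hyp_distributions n" and len: "1 < length V" and V1: "V ! 1 = 0"
    using assms(1) vertex_in_distributions [of n] by (auto simp: V_def)
  \<comment> \<open>The entries sum to 1, not to \<open>hyp_e1\<close> or \<open>hyp_e2\<close>, so
    neither component is lost.\<close>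
  have active: "active l V" for l
    by (simp add: active_iff_sum V_def sum_list_replicate del: hcomp.simps)
  have "hcomp l (negator \<Phi> V ! 1) = hcomp l (phi0 n \<Phi>)" for l
    unfolding hcomp_negator_nth [OF len] V1 hcomp_phi0
    using active [of l] assms(1) vertex_Z_eq [of n \<Phi> l]
    by (simp add: negator_comp_def V_def del: hcomp.simps)
  then have phi0: "negator \<Phi> V ! 1 = phi0 n \<Phi>"
    by (simp add: hyp_eq_iff)
  have "hcomp l (\<Phi> (negator \<Phi> V ! 1)) = 0" for l
  proof (rule negator_nth_eq_0_imp [OF assms(2)])
    show "negator \<Phi> V \<in> hyp_distributions n"
      by (rule negator_in_distributions [OF assms(2) V])
    \<comment> \<open>Activity depends only on the sum of the entries, which the negator
      preserves.\<close>
    show "active l (negator \<Phi> V)"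
      using active [of l] by (simp add: active_iff_sum sum_list_negator [OF assms(2) V])
    show "1 < n"
      using assms(1) by simp
    show "negator \<Phi> (negator \<Phi> V) ! 1 = 0"
      using inv V V1 by simp
  qed
  then have "\<Phi> (phi0 n \<Phi>) = 0"
    unfolding phi0 by (simp add: hyp_eq_iff del: hcomp.simps)
  with assms(3) show False ..
qed

end
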